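(* Let $\beta \in [0,\infty]$ and let $\Gamma \subset \mathcal{H}_K^*$ be totally bounded (with respect to the dual norm $\|\cdot\|_K$). If $f \in \mathcal{H}_{K,\Gamma}$ and $(\Lambda_n)_{n\in\mathbb{N}}$ is chosen via the $\beta$-greedy algorithm for $f$, then $$\| f - I_{K,\Lambda_n}(f) \|_{K} \xrightarrow{n \to \infty} 0.$$
   Context: $K : \mathbb{R}^d \times \mathbb{R}^d \to \mathbb{R}$ is a positive definite function: $K$ is symmetric and for every finite set $\{x_1,\dots,x_n\}\subset\mathbb{R}^d$ of pairwise distinct points the matrix $(K(x_i,x_j))_{1\le i,j\le n}$ is symmetric positive definite. $\mathcal{H}_K$ is the reproducing kernel Hilbert space of real-valued functions on $\mathbb{R}^d$ generated by $K$, with norm $\|\cdot\|_K$; $\mathcal{H}_K^*$ is its (continuous) dual space, whose dual norm is also denoted $\|\cdot\|_K$. For $\lambda \in \mathcal{H}_K^*$, $\lambda^y K(\cdot,y)$ denotes the function $x \mapsto \lambda^y K(x,y)$ ($\lambda$ applied to $K(x,\cdot)$ as a function of $y$); it belongs to $\mathcal{H}_K$ and is the Riesz representer of $\lambda$, i.e. $\lambda(f) = \langle f, \lambda^y K(\cdot,y)\rangle_{\mathcal{H}_K}$ for all $f \in \mathcal{H}_K$. For a finite linearly independent set $\Lambda = \{\lambda_1,\dots,\lambda_n\}\subset\mathcal{H}_K^*$, let $\mathcal{S}_{K,\Lambda} = \mathrm{span}\{\lambda_1^yK(\cdot,y),\dots,\lambda_n^yK(\cdot,y)\}$. For $f\in\mathcal{H}_K$,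 $I_{K,\Lambda}(f)$ is the unique $s\in\mathcal{S}_{K,\Lambda}$ with $\lambda_i(s)=\lambda_i(f)$ for all $i$; equivalently, $I_{K,\Lambda}$ is the orthogonal projection of $\mathcal{H}_K$ onto $\mathcal{S}_{K,\Lambda}$. For $\Gamma\subset\mathcal{H}_K^*$, $\mathcal{H}_{K,\Gamma}$ is the closure in $\mathcal{H}_K$ of $\mathrm{span}\{\lambda^yK(\cdot,y) \mid \lambda\in\Gamma\}$. The generalized power function is $P_\Lambda(\lambda) = \|\lambda^yK(\cdot,y) - I_{K,\Lambda}(\lambda^yK(\cdot,y))\|_K$ for $\lambda\in\Gamma$; it vanishes exactly when $\lambda\in\mathrm{span}(\Lambda)$. $\beta$-greedy algorithm for $f$: start with $\Lambda_1=\{\lambda_1\}$ for some nonzero $\lambda_1\in\Gamma$. Given $\Lambda_n$ (linearly independent), set $\Lambda_{n+1}=\Lambda_n\cup\{\lambda_{n+1}\}$, where $\lambda_{n+1}\in\Gamma\setminus\mathrm{span}(\Lambda_n)$ attains the supremum $\sup_{\lambda}\eta_n(\lambda)$ over $\lambda\in\Gamma\setminus\mathrm{span}(\Lambda_n)$ of $$\eta_n(\lambda) = |\lambda(f)-\lambda(I_{K,\Lambda_n}(f))|^{\beta}\, P_{\Lambda_n}(\lambda)^{1-\beta}\quad\text{if } \beta\in[0,\infty),$$ $$\eta_n(\lambda) = \frac{|\lambda(f)-\lambda(I_{K,\Lambda_n}(f))|}{P_{\Lambda_n}(\lambda)}\quad\text{if } \beta=\infty,$$ with the convention $t^0=1$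 for all $t\ge 0$. (It is assumed that such a maximizer exists in each step.) If $\Gamma\subset\mathrm{span}(\Lambda_n)$ for some $n$, the algorithm stops and $\Lambda_m:=\Lambda_n$ for all $m\ge n$. *)

theory Defs
  imports "HOL-Analysis.Analysis" "HOL-Library.Function_Algebras"
begin

text \<open>
  Real-valued functions form a real vector space under the pointwise operations. The
  interpretation is used both for functions on \<open>\<real>\<^sup>d\<close> and for functionals acting on such functions.
\<close>

definition fun_scale :: "real \<Rightarrow> ('x \<Rightarrow> real) \<Rightarrow> 'x \<Rightarrow> real" where
  "fun_scale c f = (\<lambda>x. c * f x)"

global_interpretation fun_vs: vector_space "fun_scale :: real \<Rightarrow> ('x \<Rightarrow> real) \<Rightarrow> 'x \<Rightarrow> real"
  by standard (auto simp: fun_scale_def fun_eq_iff algebra_simps)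

definition positive_definite_kernel :: "('x \<Rightarrow> 'x \<Rightarrow> real) \<Rightarrow> bool" where
  "positive_definite_kernel K \<longleftrightarrow>
     (\<forall>x y. K x y = K y x) \<and>
     (\<forall>X c. finite X \<longrightarrow> (\<exists>x\<in>X. c x \<noteq> 0) \<longrightarrow>
        (\<Sum>x\<in>X. \<Sum>y\<in>X. c x * c y * K x y) > 0)"

text \<open>Hilbert spaces of functions, given by a carrier \<open>H\<close> and an inner product \<open>ip\<close>\<close>

definition hnorm :: "('v \<Rightarrow> 'v \<Rightarrow> real) \<Rightarrow> 'v \<Rightarrow> real" where
  "hnorm ip f = sqrt (ip f f)"

text \<open>
  The locale \<open>Metric_space\<close> asks for nonnegativity and symmetry also outside the carrier, where
  inner products and dual norms are unspecified; hence the case distinction.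
\<close>

definition norm_dist :: "'v::minus set \<Rightarrow> ('v \<Rightarrow> real) \<Rightarrow> 'v \<Rightarrow> 'v \<Rightarrow> real" where
  "norm_dist S N u v = (if u \<in> S \<and> v \<in> S then N (u - v) else 0)"

definition inner_product_on ::
  "('x \<Rightarrow> real) set \<Rightarrow> (('x \<Rightarrow> real) \<Rightarrow> ('x \<Rightarrow> real) \<Rightarrow> real) \<Rightarrow> bool" where
  "inner_product_on H ip \<longleftrightarrow>
     fun_vs.subspace H \<and>
     (\<forall>f\<in>H. \<forall>g\<in>H. ip f g = ip g f) \<and>
     (\<forall>f\<in>H. \<forall>g\<in>H. \<forall>h\<in>H. ip (f + g) h = ip f h + ip g h) \<and>
     (\<forall>c. \<forall>f\<in>H. \<forall>g\<in>H. ip (fun_scale c f) g = c * ip f g) \<and>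
     (\<forall>f\<in>H. ip f f \<ge> 0) \<and>
     (\<forall>f\<in>H. ip f f = 0 \<longrightarrow> f = 0)"

definition hilbert_space_on ::
  "('x \<Rightarrow> real) set \<Rightarrow> (('x \<Rightarrow> real) \<Rightarrow> ('x \<Rightarrow> real) \<Rightarrow> real) \<Rightarrow> bool" where
  "hilbert_space_on H ip \<longleftrightarrow>
     inner_product_on H ip \<and> Metric_space.mcomplete H (norm_dist H (hnorm ip))"

text \<open>
  \<open>(H, ip)\<close> is the reproducing kernel Hilbert space of \<open>K\<close>. By the Moore--Aronszajn theorem such a
  pair exists for every positive definite \<open>K\<close>, and \<open>H\<close> and \<open>ip\<close> on \<open>H\<close> are determined by \<open>K\<close>.
\<close>

definition is_rkhs ::
  "('x \<Rightarrow> 'x \<Rightarrow> real) \<Rightarrow> ('x \<Rightarrow> real) set \<Rightarrow> (('x \<Rightarrow> real) \<Rightarrow> ('x \<Rightarrow> real) \<Rightarrow> real) \<Rightarrow> bool"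
where
  "is_rkhs K H ip \<longleftrightarrow>
     hilbert_space_on H ip \<and>
     (\<forall>x. (\<lambda>y. K x y) \<in> H) \<and>
     (\<forall>f\<in>H. \<forall>x. f x = ip f (\<lambda>y. K x y))"

text \<open>
  Functionals on \<open>H\<close> are represented by functions on the whole function type that vanish outside
  \<open>H\<close>, so that equality, pointwise operations and spans of functionals are those of \<open>H\<^sup>*\<close>.
\<close>

definition dual_space ::
  "('x \<Rightarrow> real) set \<Rightarrow> (('x \<Rightarrow> real) \<Rightarrow> ('x \<Rightarrow> real) \<Rightarrow> real) \<Rightarrow> (('x \<Rightarrow> real) \<Rightarrow> real) set" where
  "dual_space H ip = {l.
     (\<forall>f. f \<notin> H \<longrightarrow> l f = 0) \<and>
     (\<forall>f\<in>H. \<forall>g\<in>H. l (f + g) = l f + l g) \<and>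
     (\<forall>c. \<forall>f\<in>H. l (fun_scale c f) = c * l f) \<and>
     (\<exists>C. \<forall>f\<in>H. \<bar>l f\<bar> \<le> C * hnorm ip f)}"

definition dual_norm ::
  "('x \<Rightarrow> real) set \<Rightarrow> (('x \<Rightarrow> real) \<Rightarrow> ('x \<Rightarrow> real) \<Rightarrow> real) \<Rightarrow> (('x \<Rightarrow> real) \<Rightarrow> real) \<Rightarrow> real" where
  "dual_norm H ip l = (SUP f\<in>{f\<in>H. hnorm ip f \<le> 1}. \<bar>l f\<bar>)"

definition totally_bounded_in_dual ::
  "('x \<Rightarrow> real) set \<Rightarrow> (('x \<Rightarrow> real) \<Rightarrow> ('x \<Rightarrow> real) \<Rightarrow> real) \<Rightarrow> (('x \<Rightarrow> real) \<Rightarrow> real) set \<Rightarrow> bool"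
where
  "totally_bounded_in_dual H ip G \<longleftrightarrow>
     Metric_space.mtotally_bounded
       (dual_space H ip) (norm_dist (dual_space H ip) (dual_norm H ip)) G"

text \<open>The function \<open>\<lambda>\<^sup>y K(\<cdot>,y)\<close>\<close>

definition kernel_rep :: "('x \<Rightarrow> 'x \<Rightarrow> real) \<Rightarrow> (('x \<Rightarrow> real) \<Rightarrow> real) \<Rightarrow> 'x \<Rightarrow> real" where
  "kernel_rep K l = (\<lambda>x. l (\<lambda>y. K x y))"

text \<open>The spaces \<open>\<S>\<^bsub>K,\<Lambda>\<^esub>\<close> and \<open>\<H>\<^bsub>K,\<Gamma>\<^esub>\<close>\<close>

definition trial_space :: "('x \<Rightarrow> 'x \<Rightarrow> real) \<Rightarrow> (('x \<Rightarrow> real) \<Rightarrow> real) set \<Rightarrow> ('x \<Rightarrow> real) set" where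
  "trial_space K L = fun_vs.span (kernel_rep K ` L)"

definition generated_subspace ::
  "('x \<Rightarrow> 'x \<Rightarrow> real) \<Rightarrow> ('x \<Rightarrow> real) set \<Rightarrow> (('x \<Rightarrow> real) \<Rightarrow> ('x \<Rightarrow> real) \<Rightarrow> real) \<Rightarrow>
   (('x \<Rightarrow> real) \<Rightarrow> real) set \<Rightarrow> ('x \<Rightarrow> real) set"
where
  "generated_subspace K H ip G =
     Metric_space.mtopology H (norm_dist H (hnorm ip))
       closure_of fun_vs.span {kernel_rep K l | l. l \<in> G}"

definition interpolant ::
  "('x \<Rightarrow> 'x \<Rightarrow> real) \<Rightarrow> (('x \<Rightarrow> real) \<Rightarrow> real) set \<Rightarrow> ('x \<Rightarrow> real) \<Rightarrow> 'x \<Rightarrow> real" where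
  "interpolant K L f = (THE s. s \<in> trial_space K L \<and> (\<forall>l\<in>L. l s = l f))"

definition power_function ::
  "('x \<Rightarrow> 'x \<Rightarrow> real) \<Rightarrow> (('x \<Rightarrow> real) \<Rightarrow> ('x \<Rightarrow> real) \<Rightarrow> real) \<Rightarrow>
   (('x \<Rightarrow> real) \<Rightarrow> real) set \<Rightarrow> (('x \<Rightarrow> real) \<Rightarrow> real) \<Rightarrow> real"
where
  "power_function K ip L l = hnorm ip (kernel_rep K l - interpolant K L (kernel_rep K l))"

text \<open>Real powers with the convention \<open>t\<^sup>0 = 1\<close> for all \<open>t\<close> (in Isabelle/HOL, \<open>0 powr 0 = 0\<close>)\<close>

definition pow0 :: "real \<Rightarrow> real \<Rightarrow> real" where
  "pow0 t a = (if a = 0 then 1 else t powr a)"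

definition greedy_eta ::
  "('x \<Rightarrow> 'x \<Rightarrow> real) \<Rightarrow> (('x \<Rightarrow> real) \<Rightarrow> ('x \<Rightarrow> real) \<Rightarrow> real) \<Rightarrow> ennreal \<Rightarrow> ('x \<Rightarrow> real) \<Rightarrow>
   (('x \<Rightarrow> real) \<Rightarrow> real) set \<Rightarrow> (('x \<Rightarrow> real) \<Rightarrow> real) \<Rightarrow> real"
where
  "greedy_eta K ip \<beta> f L l =
     (if \<beta> = \<infinity> then \<bar>l f - l (interpolant K L f)\<bar> / power_function K ip L l
      else pow0 \<bar>l f - l (interpolant K L f)\<bar> (enn2real \<beta>) *
           pow0 (power_function K ip L l) (1 - enn2real \<beta>))"

text \<open>
  \<open>L\<close> is a possible outcome of the \<open>\<beta>\<close>-greedy algorithm for \<open>f\<close>; the sets are indexed from 1, and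
  \<open>L 0\<close> is irrelevant.
\<close>

definition beta_greedy ::
  "('x \<Rightarrow> 'x \<Rightarrow> real) \<Rightarrow> (('x \<Rightarrow> real) \<Rightarrow> ('x \<Rightarrow> real) \<Rightarrow> real) \<Rightarrow> (('x \<Rightarrow> real) \<Rightarrow> real) set \<Rightarrow>
   ennreal \<Rightarrow> ('x \<Rightarrow> real) \<Rightarrow> (nat \<Rightarrow> (('x \<Rightarrow> real) \<Rightarrow> real) set) \<Rightarrow> bool"
where
  "beta_greedy K ip G \<beta> f L \<longleftrightarrow>
     (\<exists>l\<in>G. l \<noteq> 0 \<and> L 1 = {l}) \<and>
     (\<forall>n\<ge>1.
        if G \<subseteq> fun_vs.span (L n) then L (Suc n) = L n
        else \<exists>l \<in> G - fun_vs.span (L n).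
               (\<forall>m \<in> G - fun_vs.span (L n).
                  greedy_eta K ip \<beta> f (L n) m \<le> greedy_eta K ip \<beta> f (L n) l) \<and>
               L (Suc n) = L n \<union> {l})"

text \<open>The two distances used above are metrics on their carriers.\<close>

lemma inner_product_on_Cauchy_Schwarz:
  assumes "inner_product_on H ip" "f \<in> H" "g \<in> H"
  shows "\<bar>ip f g\<bar> \<le> hnorm ip f * hnorm ip g"
proof -
  have sub: "fun_vs.subspace H"
    and sym: "\<And>f g. f \<in> H \<Longrightarrow> g \<in> H \<Longrightarrow> ip f g = ip g f"
    and add: "\<And>f g h. f \<in> H \<Longrightarrow> g \<in> H \<Longrightarrow> h \<in> H \<Longrightarrow> ip (f + g) h = ip f h + ip g h"
    and scale: "\<And>c f g. f \<in> H \<Longrightarrow> g \<in> H \<Longrightarrow> ip (fun_scale c f) g = c * ip f g"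
    and nonneg: "\<And>f. f \<in> H \<Longrightarrow> ip f f \<ge> 0"
    and zero: "\<And>f. f \<in> H \<Longrightarrow> ip f f = 0 \<Longrightarrow> f = 0"
    using assms(1) by (auto simp: inner_product_on_def)
  have quad: "ip (fun_scale a f + fun_scale b g) (fun_scale a f + fun_scale b g)
      = a\<^sup>2 * ip f f + 2 * a * b * ip f g + b\<^sup>2 * ip g g" for a b
  proof -
    let ?u = "fun_scale a f + fun_scale b g"
    have H: "fun_scale a f \<in> H" "fun_scale b g \<in> H" "?u \<in> H"
      using assms sub by (auto intro: fun_vs.subspace_scale fun_vs.subspace_add)
    have right: "ip h ?u = a * ip f h + b * ip g h" if "h \<in> H" for h
      using sym[OF that H(3)] add[OF H(1,2) that] scale[OF assms(2) that] scale[OF assms(3) that]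
      by presburger
    have "ip ?u ?u = a * ip f ?u + b * ip g ?u" using right[OF H(3)] .
    also have "\<dots> = a * (a * ip f f + b * ip g f) + b * (a * ip f g + b * ip g g)"
      unfolding right[OF assms(2)] right[OF assms(3)] ..
    finally show ?thesis
      unfolding sym[OF assms(3,2)] by (simp add: power2_eq_square algebra_simps)
  qed
  have "(ip f g)\<^sup>2 \<le> ip f f * ip g g"
  proof (cases "ip g g = 0")
    case True
    hence "g = fun_scale 0 g" using zero[of g] assms(3) by (simp add: fun_scale_def fun_eq_iff)
    hence "ip g f = 0" using scale[of g f 0] assms by simp
    thus ?thesis using True sym assms by simp
  next
    case False
    hence pos: "ip g g > 0" using nonneg[of g] assms(3) by simp
    have "fun_scale (ip g g) f + fun_scale (- ip f g) g \<in> H"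
      by (intro fun_vs.subspace_add[OF sub] fun_vs.subspace_scale[OF sub] assms)
    from nonneg[OF this] have "0 \<le> ip g g * (ip f f * ip g g - (ip f g)\<^sup>2)"
      unfolding quad by (simp add: power2_eq_square algebra_simps)
    thus ?thesis using pos by (simp add: zero_le_mult_iff)
  qed
  thus ?thesis
    unfolding hnorm_def by (metis real_sqrt_abs real_sqrt_le_iff real_sqrt_mult)
qed

lemma Metric_space_norm_dist:
  assumes "fun_vs.subspace S"
    and "\<And>u. u \<in> S \<Longrightarrow> N u \<ge> 0"
    and "\<And>u. u \<in> S \<Longrightarrow> N u = 0 \<longleftrightarrow> u = 0"
    and "\<And>u. u \<in> S \<Longrightarrow> N (- u) = N u"
    and "\<And>u v. u \<in> S \<Longrightarrow> v \<in> S \<Longrightarrow> N (u + v) \<le> N u + N v"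
  shows "Metric_space S (norm_dist S N)"
proof
  have diff: "u \<in> S \<Longrightarrow> v \<in> S \<Longrightarrow> u - v \<in> S" for u v
    using assms(1) by (rule fun_vs.subspace_diff)
  show "0 \<le> norm_dist S N u v" for u v
    using diff assms(2) by (simp add: norm_dist_def)
  show "norm_dist S N u v = norm_dist S N v u" for u v
    using diff[of u v] assms(4)[of "u - v"] by (auto simp: norm_dist_def)
  show "u \<in> S \<Longrightarrow> v \<in> S \<Longrightarrow> norm_dist S N u v = 0 \<longleftrightarrow> u = v" for u v
    using diff[of u v] assms(3)[of "u - v"] by (simp add: norm_dist_def)
  show "norm_dist S N u w \<le> norm_dist S N u v + norm_dist S N v w"
    if "u \<in> S" "v \<in> S" "w \<in> S" for u v w
    using that assms(5)[of "u - v" "v - w"] diff by (simp add: norm_dist_def)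
qed

lemma Metric_space_hnorm:
  assumes "inner_product_on H ip"
  shows "Metric_space H (norm_dist H (hnorm ip))"
proof (rule Metric_space_norm_dist)
  show sub: "fun_vs.subspace H" using assms by (simp add: inner_product_on_def)
  have sym: "\<And>f g. f \<in> H \<Longrightarrow> g \<in> H \<Longrightarrow> ip f g = ip g f"
    and add: "\<And>f g h. f \<in> H \<Longrightarrow> g \<in> H \<Longrightarrow> h \<in> H \<Longrightarrow> ip (f + g) h = ip f h + ip g h"
    and scale: "\<And>c f g. f \<in> H \<Longrightarrow> g \<in> H \<Longrightarrow> ip (fun_scale c f) g = c * ip f g"
    and nonneg: "\<And>f. f \<in> H \<Longrightarrow> ip f f \<ge> 0"
    and zero: "\<And>f. f \<in> H \<Longrightarrow> ip f f = 0 \<Longrightarrow> f = 0"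
    using assms by (auto simp: inner_product_on_def)
  show "0 \<le> hnorm ip u" if "u \<in> H" for u using nonneg[OF that] by (simp add: hnorm_def)
  show "hnorm ip u = 0 \<longleftrightarrow> u = 0" if "u \<in> H" for u
    using zero[OF that] scale[OF that that, of 0] by (auto simp: hnorm_def)
  show "hnorm ip (- u) = hnorm ip u" if "u \<in> H" for u
  proof -
    have e: "fun_scale (-1) u = - u" by (simp add: fun_scale_def fun_eq_iff)
    have neg: "- u \<in> H" using sub that by (rule fun_vs.subspace_neg)
    have "ip (- u) (- u) = ip u u"
      using scale[OF that neg, of "-1"] scale[OF that that, of "-1"] sym[OF neg that]
      unfolding e by linarith
    thus ?thesis by (simp add: hnorm_def)
  qed
  show "hnorm ip (u + v) \<le> hnorm ip u + hnorm ip v" if "u \<in> H" "v \<in> H" for u v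
  proof -
    have uv: "u + v \<in> H" using sub that by (rule fun_vs.subspace_add)
    have "ip (u + v) (u + v) = ip u u + 2 * ip u v + ip v v"
      using add[OF that uv] add[OF that that(1)] add[OF that that(2)] sym[OF that(1) uv]
        sym[OF that(2) uv] sym[OF that] by linarith
    also have "\<dots> \<le> (hnorm ip u + hnorm ip v)\<^sup>2"
      using inner_product_on_Cauchy_Schwarz[OF assms that] nonneg that
      by (simp add: power2_sum hnorm_def abs_le_iff)
    finally show ?thesis
      unfolding hnorm_def[of ip "u + v"]
      by (rule real_le_lsqrt[rotated]) (use nonneg that in \<open>auto simp: hnorm_def\<close>)
  qed
qed

lemma Metric_space_dual_norm:
  assumes "inner_product_on H ip"
  shows "Metric_space (dual_space H ip) (norm_dist (dual_space H ip) (dual_norm H ip))"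
proof (rule Metric_space_norm_dist)
  let ?B = "{f\<in>H. hnorm ip f \<le> 1}"
  have sub: "fun_vs.subspace H"
    and scale: "\<And>c f g. f \<in> H \<Longrightarrow> g \<in> H \<Longrightarrow> ip (fun_scale c f) g = c * ip f g"
    and sym: "\<And>f g. f \<in> H \<Longrightarrow> g \<in> H \<Longrightarrow> ip f g = ip g f"
    and nonneg: "\<And>f. f \<in> H \<Longrightarrow> ip f f \<ge> 0"
    and zero: "\<And>f. f \<in> H \<Longrightarrow> ip f f = 0 \<Longrightarrow> f = 0"
    using assms by (auto simp: inner_product_on_def)
  have "0 \<in> H" using sub by (rule fun_vs.subspace_0)
  moreover have "ip 0 0 = 0" using scale[of 0 0 0] \<open>0 \<in> H\<close> by simp
  ultimately have zB: "0 \<in> ?B" by (simp add: hnorm_def)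
  have hn: "hnorm ip f \<ge> 0" if "f \<in> H" for f using nonneg[OF that] by (simp add: hnorm_def)
  have bdd: "bdd_above ((\<lambda>f. \<bar>l f\<bar>) ` ?B)" if l: "l \<in> dual_space H ip" for l
  proof -
    obtain C where C: "\<And>f. f \<in> H \<Longrightarrow> \<bar>l f\<bar> \<le> C * hnorm ip f"
      using l unfolding dual_space_def by blast
    have "\<bar>l f\<bar> \<le> \<bar>C\<bar>" if "f \<in> ?B" for f
    proof -
      have "\<bar>l f\<bar> \<le> \<bar>C\<bar> * hnorm ip f"
        using C[of f] that hn[of f] mult_right_mono[OF abs_ge_self, of "hnorm ip f" C] by fastforce
      also have "\<dots> \<le> \<bar>C\<bar> * 1" using that by (intro mult_left_mono) auto
      finally show ?thesis by simp
    qed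
    thus ?thesis by (intro bdd_aboveI2)
  qed
  have up: "\<bar>l f\<bar> \<le> dual_norm H ip l" if "l \<in> dual_space H ip" "f \<in> ?B" for l f
    unfolding dual_norm_def using that bdd by (intro cSUP_upper)
  show "fun_vs.subspace (dual_space H ip)"
  proof (rule fun_vs.subspaceI)
    show "0 \<in> dual_space H ip"
      by (auto simp: dual_space_def hn intro!: exI[of _ 0])
    fix l m assume l: "l \<in> dual_space H ip" and m: "m \<in> dual_space H ip"
    obtain C where "\<forall>f\<in>H. \<bar>l f\<bar> \<le> C * hnorm ip f"
      using l unfolding dual_space_def by blast
    moreover obtain D where "\<forall>f\<in>H. \<bar>m f\<bar> \<le> D * hnorm ip f"
      using m unfolding dual_space_def by blast
    ultimately have "\<forall>f\<in>H. \<bar>l f + m f\<bar> \<le> (C + D) * hnorm ip f"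
      by (auto simp: distrib_right intro: order_trans[OF abs_triangle_ineq] add_mono)
    hence "\<exists>C. \<forall>f\<in>H. \<bar>l f + m f\<bar> \<le> C * hnorm ip f" by blast
    thus "l + m \<in> dual_space H ip"
      using l m unfolding dual_space_def by (simp add: distrib_left)
  next
    fix c l assume l: "l \<in> dual_space H ip"
    obtain C where C: "\<And>f. f \<in> H \<Longrightarrow> \<bar>l f\<bar> \<le> C * hnorm ip f"
      using l unfolding dual_space_def by blast
    have "\<forall>f\<in>H. \<bar>fun_scale c l f\<bar> \<le> (\<bar>c\<bar> * C) * hnorm ip f"
      using C by (auto simp: fun_scale_def abs_mult mult.assoc intro: mult_left_mono)
    hence "\<exists>C. \<forall>f\<in>H. \<bar>fun_scale c l f\<bar> \<le> C * hnorm ip f" by blast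
    thus "fun_scale c l \<in> dual_space H ip"
      using l unfolding dual_space_def by (simp add: fun_scale_def[of c l] distrib_left)
  qed
  show "0 \<le> dual_norm H ip u" if "u \<in> dual_space H ip" for u
    using up[OF that zB] by linarith
  show "dual_norm H ip (- u) = dual_norm H ip u" if "u \<in> dual_space H ip" for u
    by (simp add: dual_norm_def)
  show "dual_norm H ip (u + v) \<le> dual_norm H ip u + dual_norm H ip v"
    if uv: "u \<in> dual_space H ip" "v \<in> dual_space H ip" for u v
    unfolding dual_norm_def[of H ip "u + v"]
  proof (rule cSUP_least)
    show "?B \<noteq> {}" using zB by blast
    show "\<bar>(u + v) f\<bar> \<le> dual_norm H ip u + dual_norm H ip v" if "f \<in> ?B" for f
      using up[OF uv(1) that] up[OF uv(2) that] by simp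
  qed
  show "dual_norm H ip u = 0 \<longleftrightarrow> u = 0" if u: "u \<in> dual_space H ip" for u
  proof
    assume 0: "dual_norm H ip u = 0"
    have "u f = 0" for f
    proof (cases "f \<in> H \<and> f \<noteq> 0")
      case True
      let ?g = "fun_scale (1 / hnorm ip f) f"
      have pos: "hnorm ip f > 0" using True zero[of f] nonneg[of f] by (auto simp: hnorm_def)
      have gH: "?g \<in> H" using True sub by (auto intro: fun_vs.subspace_scale)
      have "ip ?g ?g = (1 / hnorm ip f)\<^sup>2 * ip f f"
        using scale[of f ?g "1 / hnorm ip f"] scale[of f f "1 / hnorm ip f"] sym[of f ?g] True gH
        by (simp add: power2_eq_square)
      also have "ip f f = (hnorm ip f)\<^sup>2" using True nonneg[of f] by (simp add: hnorm_def)
      finally have "hnorm ip ?g = 1" using pos by (simp add: hnorm_def[of ip ?g] power_divide)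
      hence "u ?g = 0" using up[OF u, of ?g] gH 0 by simp
      moreover have "u ?g = (1 / hnorm ip f) * u f" using u True by (simp add: dual_space_def)
      ultimately show ?thesis using pos by simp
    next
      case False
      thus ?thesis
      proof (cases "f = 0")
        case True
        have "u (fun_scale 0 0) = 0 * u 0" using u \<open>0 \<in> H\<close> unfolding dual_space_def by blast
        thus ?thesis using True by simp
      qed (use u in \<open>auto simp: dual_space_def\<close>)
    qed
    thus "u = 0" by (simp add: fun_eq_iff)
  next
    assume "u = 0"
    moreover have "?B \<noteq> {}" using zB by blast
    ultimately show "dual_norm H ip u = 0" by (simp add: dual_norm_def)
  qed
qed

end

theory Submission
  imports Defs
begin

text \<open>
  Interpolation is orthogonal projection onto the span of the Riesz representers of the selected
  functionals (\<open>interpolant_eq_projection\<close>). Write \<open>r\<^sub>n\<close> for the residual of \<open>f\<close> after \<open>n\<close> steps,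
  \<open>v(\<lambda>)\<close> for the representer of \<open>\<lambda>\<close>, and \<open>p\<^sub>n(\<lambda>)\<close> for the power function, the distance of \<open>v(\<lambda>)\<close> from
  the current trial space. The error seen by \<open>\<lambda>\<close> is \<open>e\<^sub>n(\<lambda>) = \<bar>\<langle>r\<^sub>n, v(\<lambda>)\<rangle>\<bar>\<close>, and it satisfies
  \<open>e\<^sub>n(\<lambda>) \<le> \<parallel>r\<^sub>n\<parallel> p\<^sub>n(\<lambda>)\<close>.

  The selected functionals have a vanishing score, for two reasons. Their power function tends to
  \<open>0\<close>, because \<open>p\<^sub>n\<close> of the functional selected at step \<open>n\<close> is at most its distance to every
  functional selected earlier, and \<open>\<Gamma>\<close> is totally bounded (\<open>selected_power_tendsto_0\<close>). Their
  error is of smaller order than the power function: \<open>e\<^sub>n \<le> \<parallel>r\<^sub>n - r\<^sub>n\<^sub>+\<^sub>1\<parallel> p\<^sub>n\<close>, where the increments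
  \<open>\<parallel>r\<^sub>n - r\<^sub>n\<^sub>+\<^sub>1\<parallel>\<close> are square summable by Pythagoras (\<open>ip_residual_le_increment\<close>,
  \<open>increments_tendsto_0\<close>). For \<open>\<beta> < \<infinity>\<close> the score is \<open>(e\<^sub>n / p\<^sub>n)\<^sup>\<beta> p\<^sub>n\<close> and vanishes because \<open>p\<^sub>n\<close>
  does while \<open>e\<^sub>n / p\<^sub>n\<close> stays bounded;
  for \<open>\<beta> = \<infinity>\<close> it is \<open>e\<^sub>n / p\<^sub>n\<close> and vanishes because the increments do.

  Now fix any \<open>\<lambda> \<in> \<Gamma>\<close>. If \<open>e\<^sub>n(\<lambda>)\<close> is at least \<open>c > 0\<close>, then \<open>p\<^sub>n(\<lambda>)\<close> is at least \<open>c / \<parallel>f\<parallel>\<close> and at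
  most \<open>\<parallel>v(\<lambda>)\<parallel>\<close>, so that the score of \<open>\<lambda>\<close> is bounded below by a constant that depends only on \<open>\<lambda>\<close>, \<open>f\<close>,
  \<open>\<beta>\<close> and \<open>c\<close> (\<open>selection_score_bounded_below\<close>). The maximal score tends to \<open>0\<close>, so this happens only
  finitely often; hence \<open>e\<^sub>n(\<lambda>) \<rightarrow> 0\<close> (\<open>functional_error_tendsto_0\<close>). Thus \<open>r\<^sub>n\<close> tends weakly to \<open>0\<close>
  on the closed span of the representers, which contains \<open>f\<close>, and \<open>\<parallel>r\<^sub>n\<parallel>\<^sup>2 = \<langle>r\<^sub>n, f\<rangle> \<rightarrow> 0\<close>.
  Completeness of the space enters through the Riesz representation of functionals.
\<close>

section \<open>Inner products on spaces of functions\<close>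

locale function_inner_product =
  fixes H :: "('x \<Rightarrow> real) set" and ip :: "('x \<Rightarrow> real) \<Rightarrow> ('x \<Rightarrow> real) \<Rightarrow> real"
  assumes inner: "inner_product_on H ip"
begin

lemma subspace: "fun_vs.subspace H"
  using inner by (simp add: inner_product_on_def)

lemma zero_mem [simp, intro]: "0 \<in> H"
  and add_mem [simp, intro]: "u \<in> H \<Longrightarrow> v \<in> H \<Longrightarrow> u + v \<in> H"
  and diff_mem [simp, intro]: "u \<in> H \<Longrightarrow> v \<in> H \<Longrightarrow> u - v \<in> H"
  and scale_mem [simp, intro]: "u \<in> H \<Longrightarrow> fun_scale c u \<in> H"
  using subspace by (auto intro: fun_vs.subspace_0 fun_vs.subspace_add fun_vs.subspace_diff
      fun_vs.subspace_scale)

lemma span_mem: "A \<subseteq> H \<Longrightarrow> u \<in> fun_vs.span A \<Longrightarrow> u \<in> H"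
  using fun_vs.span_minimal[OF _ subspace] by blast

lemma ip_commute: "u \<in> H \<Longrightarrow> v \<in> H \<Longrightarrow> ip u v = ip v u"
  and ip_add_left: "u \<in> H \<Longrightarrow> v \<in> H \<Longrightarrow> w \<in> H \<Longrightarrow> ip (u + v) w = ip u w + ip v w"
  and ip_scale_left: "u \<in> H \<Longrightarrow> v \<in> H \<Longrightarrow> ip (fun_scale c u) v = c * ip u v"
  and ip_nonneg: "u \<in> H \<Longrightarrow> ip u u \<ge> 0"
  and ip_definite: "u \<in> H \<Longrightarrow> ip u u = 0 \<Longrightarrow> u = 0"
  using inner by (auto simp: inner_product_on_def)

lemma ip_diff_left: "u \<in> H \<Longrightarrow> v \<in> H \<Longrightarrow> w \<in> H \<Longrightarrow> ip (u - v) w = ip u w - ip v w"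
  using ip_add_left[of "u - v" v w] by simp

lemma ip_add_right: "u \<in> H \<Longrightarrow> v \<in> H \<Longrightarrow> w \<in> H \<Longrightarrow> ip u (v + w) = ip u v + ip u w"
  and ip_diff_right: "u \<in> H \<Longrightarrow> v \<in> H \<Longrightarrow> w \<in> H \<Longrightarrow> ip u (v - w) = ip u v - ip u w"
  and ip_scale_right: "u \<in> H \<Longrightarrow> v \<in> H \<Longrightarrow> ip u (fun_scale c v) = c * ip u v"
  by (simp_all add: ip_commute[of u] ip_add_left ip_diff_left ip_scale_left)

lemmas ip_linear = ip_add_left ip_diff_left ip_scale_left ip_add_right ip_diff_right ip_scale_right

lemma ip_zero_right [simp]: "u \<in> H \<Longrightarrow> ip u 0 = 0"
  using ip_diff_right[of u 0 0] by simp

lemma hnorm_nonneg [simp]: "u \<in> H \<Longrightarrow> hnorm ip u \<ge> 0"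
  by (simp add: hnorm_def ip_nonneg)

lemma hnorm_square: "u \<in> H \<Longrightarrow> (hnorm ip u)\<^sup>2 = ip u u"
  by (simp add: hnorm_def ip_nonneg)

lemma Cauchy_Schwarz: "u \<in> H \<Longrightarrow> v \<in> H \<Longrightarrow> \<bar>ip u v\<bar> \<le> hnorm ip u * hnorm ip v"
  by (rule inner_product_on_Cauchy_Schwarz[OF inner])

lemma hnorm_scale: "u \<in> H \<Longrightarrow> hnorm ip (fun_scale c u) = \<bar>c\<bar> * hnorm ip u"
  by (simp add: hnorm_def ip_linear real_sqrt_mult flip: mult.assoc)

lemma Pythagoras:
  assumes "u \<in> H" "v \<in> H" "ip u v = 0"
  shows "(hnorm ip (u + v))\<^sup>2 = (hnorm ip u)\<^sup>2 + (hnorm ip v)\<^sup>2"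
  using assms ip_commute[of v u] by (simp add: hnorm_square ip_linear)

lemma orthogonal_to_span:
  assumes "A \<subseteq> H" "u \<in> H" "\<forall>a\<in>A. ip u a = 0" "s \<in> fun_vs.span A"
  shows "ip u s = 0"
proof -
  have "s \<in> {s \<in> H. ip u s = 0}"
  proof (rule subsetD[OF fun_vs.span_minimal assms(4)])
    show "fun_vs.subspace {s \<in> H. ip u s = 0}"
      using assms(2) by (intro fun_vs.subspaceI) (auto simp: ip_linear)
  qed (use assms in auto)
  thus ?thesis by simp
qed

section \<open>Orthogonal projection onto the span of a finite set\<close>

text \<open>
  Each new generator is made orthogonal to the previous ones by a Gram--Schmidt step, after which its
  contribution to the projection can simply be added.
\<close>

lemma orthogonal_projection_exists:
  assumes "finite A" "A \<subseteq> H" "g \<in> H"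
  shows "\<exists>s\<in>fun_vs.span A. \<forall>a\<in>A. ip (g - s) a = 0"
  using assms
proof (induction A arbitrary: g)
  case empty
  thus ?case by auto
next
  case (insert b A)
  have A: "A \<subseteq> H" and b: "b \<in> H" using insert.prems by auto
  obtain s where s: "s \<in> fun_vs.span A" "\<forall>a\<in>A. ip (g - s) a = 0"
    using insert.IH[OF A insert.prems(2)] by blast
  obtain t where t: "t \<in> fun_vs.span A" "\<forall>a\<in>A. ip (b - t) a = 0"
    using insert.IH[OF A b] by blast
  \<comment> \<open>the new direction, orthogonal to \<open>A\<close>; if it vanishes, division by \<open>0\<close> below leaves \<open>s' = s\<close>\<close>
  define b' where "b' = b - t"
  have mem: "s \<in> H" "t \<in> H" "b' \<in> H" using s t b A span_mem b'_def by auto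
  have span: "s \<in> fun_vs.span (insert b A)" "b' \<in> fun_vs.span (insert b A)"
    using s(1) t(1) fun_vs.span_mono[of A "insert b A"] fun_vs.span_base[of b "insert b A"]
    unfolding b'_def by (auto intro: fun_vs.span_diff)
  define s' where "s' = s + fun_scale (ip (g - s) b' / ip b' b') b'"
  have s': "s' \<in> fun_vs.span (insert b A)" "s' \<in> H"
    unfolding s'_def using span mem by (auto intro: fun_vs.span_add fun_vs.span_scale)
  have *: "ip (g - s') h = ip (g - s) h - ip (g - s) b' / ip b' b' * ip b' h" if "h \<in> H" for h
    using that mem insert.prems by (simp add: s'_def ip_linear)
  have orth: "\<forall>a\<in>A. ip (g - s') a = 0"
    using * s(2) t(2) A unfolding b'_def by auto
  have "ip (g - s') b' = 0"
    using *[OF mem(3)] ip_definite[of b'] mem insert.prems by (cases "ip b' b' = 0") auto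
  moreover have "ip (g - s') t = 0"
    using orthogonal_to_span[OF A _ orth t(1)] insert.prems s' by auto
  ultimately have "ip (g - s') b = 0"
    using mem s' insert.prems b unfolding b'_def by (simp add: ip_linear)
  thus ?case using orth s' by blast
qed

definition projection :: "('x \<Rightarrow> real) set \<Rightarrow> ('x \<Rightarrow> real) \<Rightarrow> 'x \<Rightarrow> real" where
  "projection A g = (THE s. s \<in> fun_vs.span A \<and> (\<forall>a\<in>A. ip (g - s) a = 0))"

definition residual :: "('x \<Rightarrow> real) set \<Rightarrow> ('x \<Rightarrow> real) \<Rightarrow> 'x \<Rightarrow> real" where
  "residual A g = g - projection A g"

context
  fixes A :: "('x \<Rightarrow> real) set"
  assumes fin: "finite A" and AH: "A \<subseteq> H"
begin

lemma projection_ex1: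
  assumes "g \<in> H"
  shows "\<exists>!s. s \<in> fun_vs.span A \<and> (\<forall>a\<in>A. ip (g - s) a = 0)"
proof (rule ex_ex1I)
  show "\<exists>s. s \<in> fun_vs.span A \<and> (\<forall>a\<in>A. ip (g - s) a = 0)"
    using orthogonal_projection_exists[OF fin AH assms] by blast
  fix s t assume st: "s \<in> fun_vs.span A \<and> (\<forall>a\<in>A. ip (g - s) a = 0)"
    "t \<in> fun_vs.span A \<and> (\<forall>a\<in>A. ip (g - t) a = 0)"
  have mem: "s \<in> H" "t \<in> H" using st span_mem AH by auto
  have d: "s - t \<in> fun_vs.span A" using st by (auto intro: fun_vs.span_diff)
  have "ip (g - t) (s - t) = 0" "ip (g - s) (s - t) = 0"
    using orthogonal_to_span[OF AH _ _ d] st mem assms by auto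
  hence "ip (s - t) (s - t) = 0" using mem assms by (simp add: ip_linear)
  thus "s = t" using ip_definite[of "s - t"] mem by simp
qed

lemma
  assumes "g \<in> H"
  shows projection_span: "projection A g \<in> fun_vs.span A"
    and projection_mem: "projection A g \<in> H"
    and residual_mem: "residual A g \<in> H"
    and residual_orthogonal: "s \<in> fun_vs.span A \<Longrightarrow> ip (residual A g) s = 0"
proof -
  have p: "projection A g \<in> fun_vs.span A" "\<forall>a\<in>A. ip (residual A g) a = 0"
    using theI'[OF projection_ex1[OF assms]] unfolding projection_def residual_def by auto
  thus 1: "projection A g \<in> fun_vs.span A" "projection A g \<in> H" using span_mem AH by auto
  thus "residual A g \<in> H" using assms by (auto simp: residual_def)
  thus "ip (residual A g) s = 0" if "s \<in> fun_vs.span A"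
    using orthogonal_to_span[OF AH _ p(2) that] by simp
qed

lemma residual_le_distance:
  assumes "g \<in> H" "s \<in> fun_vs.span A"
  shows "hnorm ip (residual A g) \<le> hnorm ip (g - s)"
proof -
  let ?d = "projection A g - s"
  have d: "?d \<in> fun_vs.span A"
    using assms projection_span by (auto intro: fun_vs.span_diff)
  hence mem: "?d \<in> H" "residual A g \<in> H" "g - s \<in> H"
    using span_mem AH residual_mem assms by auto
  have split: "g - s = residual A g + ?d" by (simp add: residual_def)
  have "(hnorm ip (g - s))\<^sup>2 = (hnorm ip (residual A g))\<^sup>2 + (hnorm ip ?d)\<^sup>2"
    unfolding split by (rule Pythagoras[OF mem(2,1) residual_orthogonal[OF assms(1) d]])
  hence "(hnorm ip (residual A g))\<^sup>2 \<le> (hnorm ip (g - s))\<^sup>2" by simp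
  thus ?thesis using power2_le_imp_le mem hnorm_nonneg by blast
qed

lemma residual_le: "g \<in> H \<Longrightarrow> hnorm ip (residual A g) \<le> hnorm ip g"
  using residual_le_distance[of g 0] fun_vs.span_zero[of A] by (metis diff_zero)

lemma ip_residual_residual:
  assumes "g \<in> H" "v \<in> H"
  shows "ip (residual A g) (residual A v) = ip (residual A g) v"
  using assms projection_mem residual_mem residual_orthogonal projection_span
  by (simp add: residual_def[of A v] ip_diff_right)

end

text \<open>
  The part of the residual that a new generator \<open>v\<close> sees lies in the increment \<open>d\<close> of the
  projection, and \<open>d\<close> is orthogonal to the old span, so that only the residual of \<open>v\<close> matters.
\<close>

lemma ip_residual_le_increment:
  assumes "finite B" "A \<subseteq> B" "B \<subseteq> H" "g \<in> H" "v \<in> B"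
  shows "\<bar>ip (residual A g) v\<bar>
    \<le> hnorm ip (residual A g - residual B g) * hnorm ip (residual A v)"
proof -
  define d where "d = residual A g - residual B g"
  have A: "finite A" "A \<subseteq> H" and v: "v \<in> H" using assms finite_subset by auto
  note mem = residual_mem[OF A] residual_mem[OF assms(1,3)] projection_mem[OF A]
  have "ip (residual A g) v = ip d v"
    using residual_orthogonal[OF assms(1,3,4)] fun_vs.span_base[of v B] assms v
    by (simp add: d_def ip_linear mem)
  also have "\<dots> = ip d (residual A v) + ip d (projection A v)"
    using assms(4) v mem by (simp add: d_def residual_def[of A v] ip_diff_right)
  also have "ip d (projection A v) = 0"
    using residual_orthogonal[OF A assms(4)] residual_orthogonal[OF assms(1,3,4)]
      projection_span[OF A v] fun_vs.span_mono[OF assms(2)] assms(4) v mem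
    by (auto simp: d_def ip_diff_left)
  finally have "ip (residual A g) v = ip d (residual A v)" by simp
  moreover have "d \<in> H" "residual A v \<in> H" using assms(4) v mem by (auto simp: d_def)
  ultimately show ?thesis using Cauchy_Schwarz[of d "residual A v"] by (simp add: d_def)
qed

lemma increment_square:
  assumes "finite B" "A \<subseteq> B" "B \<subseteq> H" "g \<in> H"
  shows "(hnorm ip (residual A g - residual B g))\<^sup>2
    = (hnorm ip (residual A g))\<^sup>2 - (hnorm ip (residual B g))\<^sup>2"
proof -
  let ?d = "residual A g - residual B g"
  have A: "finite A" "A \<subseteq> H" using assms finite_subset by auto
  note mem = residual_mem[OF A assms(4)] residual_mem[OF assms(1,3,4)]
  have "?d = projection B g - projection A g" by (simp add: residual_def)
  moreover have "\<dots> \<in> fun_vs.span B"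
    using projection_span[OF A assms(4)] projection_span[OF assms(1,3,4)]
      fun_vs.span_mono[OF assms(2)] by (auto intro: fun_vs.span_diff)
  ultimately have "ip (residual B g) ?d = 0"
    using residual_orthogonal[OF assms(1,3,4)] by simp
  thus ?thesis using Pythagoras[of "residual B g" ?d] mem by simp
qed

text \<open>
  Each squared increment is the decrease of the squared residual norm, which converges because it is
  decreasing and nonnegative.
\<close>

lemma increments_tendsto_0:
  assumes "\<And>n. finite (A n)" "\<And>n. A n \<subseteq> A (Suc n)" "\<And>n. A n \<subseteq> H" "g \<in> H"
  shows "(\<lambda>n. hnorm ip (residual (A n) g - residual (A (Suc n)) g)) \<longlonglongrightarrow> 0"
proof -
  let ?r = "\<lambda>n. (hnorm ip (residual (A n) g))\<^sup>2"
  have sq: "(hnorm ip (residual (A n) g - residual (A (Suc n)) g))\<^sup>2 = ?r n - ?r (Suc n)" for n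
    by (rule increment_square[OF assms(1,2,3,4)])
  have "decseq ?r"
  proof (rule decseq_SucI)
    show "?r (Suc n) \<le> ?r n" for n
      using sq[of n] zero_le_power2[of "hnorm ip (residual (A n) g - residual (A (Suc n)) g)"]
      by linarith
  qed
  then obtain L where "?r \<longlonglongrightarrow> L"
    using decseq_convergent[of ?r 0] by auto
  from tendsto_diff[OF this LIMSEQ_Suc[OF this]]
  have "(\<lambda>n. sqrt (?r n - ?r (Suc n))) \<longlonglongrightarrow> sqrt (L - L)"
    by (rule tendsto_real_sqrt)
  moreover have "sqrt (?r n - ?r (Suc n)) = hnorm ip (residual (A n) g - residual (A (Suc n)) g)" for n
    using residual_mem[OF assms(1,3,4)] by (simp flip: sq)
  ultimately show ?thesis by simp
qed

end

section \<open>Riesz representation\<close>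

text \<open>
  The representer of a functional \<open>l\<close> minimises \<open>J g = \<parallel>g\<parallel>\<^sup>2 / 2 - l g\<close>. Comparing \<open>J\<close> at a
  near-minimiser \<open>g\<close> with \<open>J (g + t h)\<close> for all \<open>t\<close> yields a nonnegative quadratic polynomial in
  \<open>t\<close>, whose discriminant bounds the defect of \<open>g\<close> as a representer.
\<close>

lemma (in function_inner_product) approximate_representer:
  assumes l: "l \<in> dual_space H ip" and \<epsilon>: "\<epsilon> > 0"
  shows "\<exists>g\<in>H. \<forall>h\<in>H. \<bar>ip g h - l h\<bar> \<le> \<epsilon> * hnorm ip h"
proof -
  have l_add: "\<And>u v. u \<in> H \<Longrightarrow> v \<in> H \<Longrightarrow> l (u + v) = l u + l v"
    and l_scale: "\<And>c u. u \<in> H \<Longrightarrow> l (fun_scale c u) = c * l u"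
    using l by (auto simp: dual_space_def)
  obtain C where C: "\<And>u. u \<in> H \<Longrightarrow> \<bar>l u\<bar> \<le> C * hnorm ip u"
    using l unfolding dual_space_def by blast
  define J where "J u = ip u u / 2 - l u" for u
  have "- (C\<^sup>2 / 2) \<le> J u" if "u \<in> H" for u
  proof -
    have "0 \<le> (hnorm ip u - C)\<^sup>2" by simp
    thus ?thesis using C[OF that] hnorm_square[OF that]
      by (auto simp: J_def power2_diff abs_le_iff algebra_simps)
  qed
  hence bdd: "bdd_below (J ` H)" by (rule bdd_belowI2)
  have "J ` H \<noteq> {}" using zero_mem by blast
  moreover have "Inf (J ` H) < Inf (J ` H) + \<epsilon>\<^sup>2 / 2" using \<epsilon> by simp
  ultimately have "\<exists>x\<in>J ` H. x < Inf (J ` H) + \<epsilon>\<^sup>2 / 2" by (rule cInf_lessD)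
  then obtain g where g: "g \<in> H" "J g < Inf (J ` H) + \<epsilon>\<^sup>2 / 2" by auto
  have "\<bar>ip g h - l h\<bar> \<le> \<epsilon> * hnorm ip h" if h: "h \<in> H" for h
  proof -
    let ?a = "ip g h - l h" and ?q = "ip h h"
    have quad: "0 \<le> \<epsilon>\<^sup>2 / 2 + t * ?a + t\<^sup>2 * ?q / 2" for t
    proof -
      have "Inf (J ` H) \<le> J (g + fun_scale t h)"
        using bdd g h by (intro cINF_lower) auto
      also have "\<dots> = J g + t * ?a + t\<^sup>2 * ?q / 2"
        using g h ip_commute[of h g]
        by (simp add: J_def ip_linear l_add l_scale power2_eq_square field_simps)
      finally show ?thesis using g by linarith
    qed
    have "?a\<^sup>2 \<le> \<epsilon>\<^sup>2 * ?q"
    proof (cases "?q = 0")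
      case True
      have "?a = 0"
      proof (rule ccontr)
        assume a: "?a \<noteq> 0"
        \<comment> \<open>the polynomial is then affine in \<open>t\<close> and negative at \<open>t = - \<epsilon>\<^sup>2 / (\<langle>g, h\<rangle> - l h)\<close>\<close>
        have "0 \<le> \<epsilon>\<^sup>2 / 2 - \<epsilon>\<^sup>2" using quad[of "- \<epsilon>\<^sup>2 / ?a"] True a by simp
        thus False using \<epsilon> by simp
      qed
      thus ?thesis using True by simp
    next
      case False
      hence q: "?q > 0" using ip_nonneg[OF h] by simp
      have "- ?a / ?q * ?a + (- ?a / ?q)\<^sup>2 * ?q / 2 = - (?a\<^sup>2 / ?q / 2)"
        using q by (simp add: power2_eq_square del: minus_diff_eq)
      hence "0 \<le> \<epsilon>\<^sup>2 / 2 - ?a\<^sup>2 / ?q / 2" using quad[of "- ?a / ?q"] by linarith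
      thus ?thesis using q by (simp add: field_simps)
    qed
    also have "\<dots> = (\<epsilon> * hnorm ip h)\<^sup>2" by (simp add: power_mult_distrib hnorm_square[OF h])
    finally show ?thesis
      using \<epsilon> h by (subst (asm) power2_le_iff_abs_le) auto
  qed
  thus ?thesis using g by blast
qed

text \<open>
  Near-representers with errors tending to \<open>0\<close> form a Cauchy sequence; its limit is the representer.
\<close>

theorem (in function_inner_product) Riesz_representation:
  assumes complete: "Metric_space.mcomplete H (norm_dist H (hnorm ip))"
    and l: "l \<in> dual_space H ip"
  shows "\<exists>w\<in>H. \<forall>h\<in>H. ip w h = l h"
proof -
  interpret M: Metric_space H "norm_dist H (hnorm ip)" by (rule Metric_space_hnorm[OF inner])
  define \<epsilon> where "\<epsilon> n = inverse (real (Suc n))" for n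
  have \<epsilon>: "\<epsilon> n > 0" for n by (simp add: \<epsilon>_def)
  obtain g where g: "\<And>n. g n \<in> H"
    and near: "\<And>n h. h \<in> H \<Longrightarrow> \<bar>ip (g n) h - l h\<bar> \<le> \<epsilon> n * hnorm ip h"
    using approximate_representer[OF l \<epsilon>] by metis
  have dist: "hnorm ip (g m - g n) \<le> \<epsilon> m + \<epsilon> n" for m n
  proof (cases "hnorm ip (g m - g n) = 0")
    case False
    let ?h = "g m - g n"
    have h: "?h \<in> H" using g by auto
    have "(hnorm ip ?h)\<^sup>2 = (ip (g m) ?h - l ?h) - (ip (g n) ?h - l ?h)"
      by (simp only: hnorm_square[OF h] ip_diff_left[OF g g h])
    also have "\<dots> \<le> (\<epsilon> m + \<epsilon> n) * hnorm ip ?h"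
      using near[OF h, of m] near[OF h, of n] unfolding distrib_right by linarith
    finally show ?thesis
      using False hnorm_nonneg[OF h] by (simp add: power2_eq_square)
  qed (use \<epsilon> in \<open>simp add: add_nonneg_nonneg less_imp_le\<close>)
  have lim: "\<epsilon> \<longlonglongrightarrow> 0" unfolding \<epsilon>_def by (rule LIMSEQ_inverse_real_of_nat)
  have "M.MCauchy g"
    unfolding M.MCauchy_def
  proof (intro conjI allI impI)
    show "range g \<subseteq> H" using g by auto
    fix e :: real assume "e > 0"
    hence "\<forall>\<^sub>F n in sequentially. \<epsilon> n < e / 2" using order_tendstoD(2)[OF lim, of "e / 2"] by simp
    then obtain N where N: "\<And>n. n \<ge> N \<Longrightarrow> \<epsilon> n < e / 2" by (auto simp: eventually_sequentially)
    have "norm_dist H (hnorm ip) (g m) (g n) < e" if "N \<le> m" "N \<le> n" for m n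
      using dist[of m n] N[OF that(1)] N[OF that(2)] g by (simp add: norm_dist_def)
    thus "\<exists>N. \<forall>n n'. N \<le> n \<longrightarrow> N \<le> n' \<longrightarrow> norm_dist H (hnorm ip) (g n) (g n') < e" by blast
  qed
  then obtain w where w: "limitin M.mtopology g w sequentially"
    using complete unfolding M.mcomplete_def by blast
  have wH: "w \<in> H" using w by (simp add: M.limitin_metric)
  have gw: "(\<lambda>n. hnorm ip (g n - w)) \<longlonglongrightarrow> 0"
    using w wH g by (simp add: M.limitin_metric_dist_null norm_dist_def)
  have "ip w h = l h" if h: "h \<in> H" for h
  proof -
    have "(\<lambda>n. ip (g n) h - ip w h) \<longlonglongrightarrow> 0"
    proof (rule Lim_null_comparison)
      show "\<forall>\<^sub>F n in sequentially. norm (ip (g n) h - ip w h) \<le> hnorm ip (g n - w) * hnorm ip h"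
        using Cauchy_Schwarz[of "g _ - w" h] g wH h by (simp add: ip_diff_left)
      show "(\<lambda>n. hnorm ip (g n - w) * hnorm ip h) \<longlonglongrightarrow> 0"
        using tendsto_mult_left_zero[OF gw] by simp
    qed
    hence "(\<lambda>n. ip (g n) h) \<longlonglongrightarrow> ip w h" by (simp add: LIM_zero_iff)
    moreover have "(\<lambda>n. ip (g n) h - l h) \<longlonglongrightarrow> 0"
    proof (rule Lim_null_comparison)
      show "\<forall>\<^sub>F n in sequentially. norm (ip (g n) h - l h) \<le> \<epsilon> n * hnorm ip h"
        using near[OF h] by simp
      show "(\<lambda>n. \<epsilon> n * hnorm ip h) \<longlonglongrightarrow> 0" by (rule tendsto_mult_left_zero[OF lim])
    qed
    hence "(\<lambda>n. ip (g n) h) \<longlonglongrightarrow> l h" by (simp add: LIM_zero_iff)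
    ultimately show ?thesis by (rule LIMSEQ_unique)
  qed
  thus ?thesis using wH by blast
qed

section \<open>Generalized interpolation in a reproducing kernel Hilbert space\<close>

locale reproducing_kernel_space =
  fixes K :: "'x \<Rightarrow> 'x \<Rightarrow> real" and H and ip
  assumes rkhs: "is_rkhs K H ip"

sublocale reproducing_kernel_space \<subseteq> function_inner_product H ip
  using rkhs by unfold_locales (simp add: is_rkhs_def hilbert_space_on_def)

context reproducing_kernel_space
begin

text \<open>
  The value at \<open>x\<close> of the Riesz representer of \<open>l\<close> is its inner product with the kernel translate
  at \<open>x\<close>, hence the value of \<open>l\<close> at that translate.
\<close>

lemma
  assumes "l \<in> dual_space H ip"
  shows kernel_rep_mem: "kernel_rep K l \<in> H"
    and ip_kernel_rep: "g \<in> H \<Longrightarrow> ip g (kernel_rep K l) = l g"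
proof -
  obtain w where w: "w \<in> H" "\<forall>h\<in>H. ip w h = l h"
    using Riesz_representation[OF _ assms] rkhs unfolding is_rkhs_def hilbert_space_on_def by blast
  have "w x = kernel_rep K l x" for x
  proof -
    have "(\<lambda>y. K x y) \<in> H" and "w x = ip w (\<lambda>y. K x y)"
      using rkhs w(1) unfolding is_rkhs_def by blast+
    thus ?thesis using w(2) by (simp add: kernel_rep_def)
  qed
  hence "w = kernel_rep K l" by blast
  thus "kernel_rep K l \<in> H" "g \<in> H \<Longrightarrow> ip g (kernel_rep K l) = l g"
    using w ip_commute by auto
qed

lemma hnorm_kernel_rep_le:
  assumes l: "l \<in> dual_space H ip"
  shows "hnorm ip (kernel_rep K l) \<le> dual_norm H ip l"
proof -
  let ?w = "kernel_rep K l"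
  have w: "?w \<in> H" by (rule kernel_rep_mem[OF l])
  have bdd: "bdd_above ((\<lambda>f. \<bar>l f\<bar>) ` {f \<in> H. hnorm ip f \<le> 1})"
  proof (rule bdd_aboveI2)
    fix g assume g: "g \<in> {f \<in> H. hnorm ip f \<le> 1}"
    have "\<bar>l g\<bar> \<le> hnorm ip g * hnorm ip ?w"
      using Cauchy_Schwarz[of g ?w] g w ip_kernel_rep[OF l, of g] by simp
    also have "\<dots> \<le> 1 * hnorm ip ?w" using g w by (intro mult_right_mono) auto
    finally show "\<bar>l g\<bar> \<le> hnorm ip ?w" by simp
  qed
  have up: "\<bar>l g\<bar> \<le> dual_norm H ip l" if "g \<in> H" "hnorm ip g \<le> 1" for g
    unfolding dual_norm_def using that bdd by (intro cSUP_upper) auto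
  \<comment> \<open>the unit vector at which \<open>l\<close> attains its norm, or \<open>0\<close> if the representer vanishes\<close>
  define u where "u = fun_scale (inverse (hnorm ip ?w)) ?w"
  have u: "u \<in> H" "hnorm ip u \<le> 1"
    using w by (auto simp: u_def hnorm_scale) (cases "hnorm ip ?w = 0"; simp)
  have "l u = inverse (hnorm ip ?w) * (hnorm ip ?w)\<^sup>2"
    using ip_kernel_rep[OF l u(1)] w by (simp add: u_def ip_linear hnorm_square)
  thus ?thesis using up[OF u] by (simp add: power2_eq_square field_simps split: if_splits)
qed

lemma kernel_rep_span:
  assumes "l \<in> fun_vs.span L"
  shows "kernel_rep K l \<in> fun_vs.span (kernel_rep K ` L)"
proof -
  have "l \<in> {l. kernel_rep K l \<in> fun_vs.span (kernel_rep K ` L)}"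
  proof (rule subsetD[OF fun_vs.span_minimal assms])
    have "kernel_rep K (l + m) = kernel_rep K l + kernel_rep K m"
      and "kernel_rep K (fun_scale c l) = fun_scale c (kernel_rep K l)"
      and "kernel_rep K 0 = 0" for l m c
      by (auto simp: kernel_rep_def fun_scale_def fun_eq_iff)
    thus "fun_vs.subspace {l. kernel_rep K l \<in> fun_vs.span (kernel_rep K ` L)}"
      by (intro fun_vs.subspaceI)
        (auto intro: fun_vs.span_add fun_vs.span_scale fun_vs.span_zero)
  qed (auto intro: fun_vs.span_base)
  thus ?thesis by simp
qed

context
  fixes L
  assumes fin: "finite L" and LH: "L \<subseteq> dual_space H ip"
begin

lemma finite_reps: "finite (kernel_rep K ` L)" "kernel_rep K ` L \<subseteq> H"
  using fin LH kernel_rep_mem by auto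

lemma interpolant_eq_projection:
  assumes "g \<in> H"
  shows "interpolant K L g = projection (kernel_rep K ` L) g"
  unfolding interpolant_def projection_def
proof (rule arg_cong[where f = The], intro ext conj_cong refl)
  show "s \<in> trial_space K L \<longleftrightarrow> s \<in> fun_vs.span (kernel_rep K ` L)" for s
    by (simp add: trial_space_def)
  fix s assume "s \<in> fun_vs.span (kernel_rep K ` L)"
  hence s: "s \<in> H" using span_mem finite_reps by blast
  have "l s = l g \<longleftrightarrow> ip (g - s) (kernel_rep K l) = 0" if "l \<in> L" for l
    using that LH s assms ip_kernel_rep[of l s] ip_kernel_rep[of l g] kernel_rep_mem[of l]
    by (auto simp: ip_diff_left)
  thus "(\<forall>l\<in>L. l s = l g) \<longleftrightarrow> (\<forall>a\<in>kernel_rep K ` L. ip (g - s) a = 0)" by auto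
qed

lemma interpolation_error: "g \<in> H \<Longrightarrow> g - interpolant K L g = residual (kernel_rep K ` L) g"
  by (simp add: interpolant_eq_projection residual_def)

lemma power_function_eq:
  "l \<in> dual_space H ip
    \<Longrightarrow> power_function K ip L l = hnorm ip (residual (kernel_rep K ` L) (kernel_rep K l))"
  by (simp add: power_function_def interpolation_error kernel_rep_mem)

lemma functional_error:
  assumes "g \<in> H" "l \<in> dual_space H ip"
  shows "l g - l (interpolant K L g) = ip (residual (kernel_rep K ` L) g) (kernel_rep K l)"
proof -
  let ?s = "projection (kernel_rep K ` L) g"
  have s: "?s \<in> H" by (rule projection_mem[OF finite_reps assms(1)])
  have "ip (residual (kernel_rep K ` L) g) (kernel_rep K l)
      = ip g (kernel_rep K l) - ip ?s (kernel_rep K l)"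
    unfolding residual_def by (rule ip_diff_left[OF assms(1) s kernel_rep_mem[OF assms(2)]])
  thus ?thesis
    using assms s by (simp add: interpolant_eq_projection ip_kernel_rep)
qed

end

end

section \<open>The greedy selection criterion\<close>

definition selection_score :: "ennreal \<Rightarrow> real \<Rightarrow> real \<Rightarrow> real" where
  "selection_score \<beta> e p =
     (if \<beta> = \<infinity> then e / p else pow0 e (enn2real \<beta>) * pow0 p (1 - enn2real \<beta>))"

text \<open>
  For positive \<open>p\<close>, the score is \<open>(e / p)\<^sup>\<beta> p\<close> for finite \<open>\<beta>\<close>, so an error that is a
  bounded multiple of the power function forces the score to vanish with the power function.
\<close>

lemma pow0_score_le:
  assumes "0 \<le> b" "0 \<le> e" "0 \<le> p" "e \<le> C * p" "0 \<le> C"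
  shows "pow0 e b * pow0 p (1 - b) \<le> pow0 C b * p"
\<comment> \<open>\<open>p = 0\<close> forces \<open>e = 0\<close>, and both sides are then \<open>0\<close>, also under the convention \<open>0\<^sup>0 = 1\<close>\<close>
proof (cases "p = 0 \<or> b = 0")
  case True
  thus ?thesis using assms by (auto simp: pow0_def)
next
  case False
  hence p: "p > 0" and b: "b > 0" using assms by auto
  have "pow0 p (1 - b) = p powr (1 - b)" using p by (simp add: pow0_def)
  moreover have "e powr b \<le> (C * p) powr b" using assms b by (intro powr_mono2) auto
  ultimately have "pow0 e b * pow0 p (1 - b) \<le> (C * p) powr b * p powr (1 - b)"
    using b by (simp add: pow0_def mult_right_mono)
  also have "\<dots> = C powr b * p"
    using p assms by (simp add: powr_mult mult.assoc flip: powr_add)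
  finally show ?thesis using b by (simp add: pow0_def)
qed

lemma selection_score_tendsto_0:
  assumes "\<And>n. 0 \<le> e n" "\<And>n. 0 \<le> p n" "\<And>n. 0 \<le> d n" "\<And>n. e n \<le> d n * p n"
    and d: "d \<longlonglongrightarrow> 0" and p: "p \<longlonglongrightarrow> 0"
  shows "(\<lambda>n. selection_score \<beta> (e n) (p n)) \<longlonglongrightarrow> 0"
proof (cases "\<beta> = \<infinity>")
  case True
  have "norm (selection_score \<beta> (e n) (p n)) \<le> d n" for n
    using assms(1-4)[of n] True by (cases "p n = 0") (auto simp: selection_score_def field_simps)
  thus ?thesis by (intro Lim_null_comparison[OF _ d]) auto
next
  case False
  obtain C where C: "C > 0" "\<And>n. \<bar>d n\<bar> \<le> C"
    using convergent_imp_Bseq[OF convergentI[OF d]] by (auto simp: Bseq_def)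
  have bound: "norm (selection_score \<beta> (e n) (p n)) \<le> pow0 C (enn2real \<beta>) * p n" for n
  proof -
    have "e n \<le> C * p n"
      using assms(2,4)[of n] C(2)[of n] by (meson abs_le_D1 mult_right_mono order_trans)
    hence "pow0 (e n) (enn2real \<beta>) * pow0 (p n) (1 - enn2real \<beta>) \<le> pow0 C (enn2real \<beta>) * p n"
      using assms(1,2)[of n] C by (intro pow0_score_le) auto
    thus ?thesis using False by (simp add: selection_score_def pow0_def)
  qed
  show ?thesis
  proof (rule Lim_null_comparison)
    show "\<forall>\<^sub>F n in sequentially.
        norm (selection_score \<beta> (e n) (p n)) \<le> pow0 C (enn2real \<beta>) * p n"
      using bound by simp
    show "(\<lambda>n. pow0 C (enn2real \<beta>) * p n) \<longlonglongrightarrow> 0" by (rule tendsto_mult_right_zero[OF p])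
  qed
qed

text \<open>
  An error bounded below keeps the power function between \<open>c / C\<close> and \<open>D\<close>, that is, inside a compact
  interval of positive numbers; the second factor of the score is monotone there.
\<close>

lemma selection_score_bounded_below:
  assumes "0 < c" "0 < C" "0 < D"
  obtains \<delta> where "\<delta> > 0"
    "\<And>e p. c \<le> e \<Longrightarrow> e \<le> C * p \<Longrightarrow> p \<le> D \<Longrightarrow> \<delta> \<le> selection_score \<beta> e p"
proof (cases "\<beta> = \<infinity>")
  case True
  show ?thesis
  proof (rule that[of "c / D"])
    fix e p assume ep: "c \<le> e" "e \<le> C * p" "p \<le> D"
    hence "0 < C * p" using assms by linarith
    hence "p > 0" using assms by (simp add: zero_less_mult_iff)
    thus "c / D \<le> selection_score \<beta> e p"
      using True ep assms by (auto simp: selection_score_def intro: frac_le)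
  qed (use assms in auto)
next
  case False
  define b where "b = enn2real \<beta>"
  show ?thesis
  proof (rule that[of "c powr b * min ((c / C) powr (1 - b)) (D powr (1 - b))"])
    fix e p assume ep: "c \<le> e" "e \<le> C * p" "p \<le> D"
    have pos: "p \<ge> c / C" "c / C > 0" using ep assms by (auto simp: field_simps)
    have "min ((c / C) powr (1 - b)) (D powr (1 - b)) \<le> p powr (1 - b)"
    proof (cases "b \<le> 1")
      case True
      hence "(c / C) powr (1 - b) \<le> p powr (1 - b)" using pos by (intro powr_mono2) auto
      thus ?thesis by simp
    next
      case False
      hence "D powr (1 - b) \<le> p powr (1 - b)" using pos ep by (intro powr_mono2') auto
      thus ?thesis by simp
    qed
    moreover have "c powr b \<le> e powr b"
      using ep assms by (intro powr_mono2) (auto simp: b_def)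
    ultimately have "c powr b * min ((c / C) powr (1 - b)) (D powr (1 - b)) \<le> e powr b * p powr (1 - b)"
      by (intro mult_mono) auto
    moreover have "pow0 e b = e powr b" "pow0 p (1 - b) = p powr (1 - b)"
      using ep pos assms by (auto simp: pow0_def)
    ultimately show "c powr b * min ((c / C) powr (1 - b)) (D powr (1 - b)) \<le> selection_score \<beta> e p"
      using False by (simp add: selection_score_def b_def)
  qed (use assms in auto)
qed

section \<open>Convergence of the greedy algorithm\<close>

lemma nonneg_tendsto_0I:
  fixes q :: "nat \<Rightarrow> real"
  assumes "\<And>n. 0 \<le> q n" "\<And>\<epsilon>. \<epsilon> > 0 \<Longrightarrow> \<forall>\<^sub>F n in sequentially. q n < \<epsilon>"
  shows "q \<longlonglongrightarrow> 0"
  using assms by (intro tendstoI) simp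

text \<open>
  By the pigeonhole principle, at most one index per ball of a finite net can have \<open>q n\<close> at least
  the diameter of the balls.
\<close>

lemma (in Metric_space) mtotally_bounded_escape:
  assumes S: "mtotally_bounded S" "\<And>n. x n \<in> S"
    and q: "\<And>n::nat. 0 \<le> q n" "\<And>m n. m < n \<Longrightarrow> q n \<le> d (x m) (x n)"
  shows "q \<longlonglongrightarrow> (0::real)"
proof (rule nonneg_tendsto_0I[OF q(1)])
  fix \<epsilon> :: real assume "0 < \<epsilon>"
  then obtain F where F: "finite F" "S \<subseteq> (\<Union>y\<in>F. mball y (\<epsilon> / 2))"
    using S(1) unfolding mtotally_bounded_def by (meson half_gt_zero)
  hence "\<forall>n. \<exists>y\<in>F. x n \<in> mball y (\<epsilon> / 2)" using S(2) by blast
  then obtain g where g: "\<And>n. g n \<in> F" "\<And>n. x n \<in> mball (g n) (\<epsilon> / 2)" by metis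
  have no_pair: "\<not> (m < n \<and> g m = g n \<and> \<epsilon> \<le> q n)" for m n
  proof
    assume mn: "m < n \<and> g m = g n \<and> \<epsilon> \<le> q n"
    have "d (x m) (x n) \<le> d (x m) (g m) + d (g m) (x n)"
      using g(2)[of m] g(2)[of n] mn by (intro triangle) auto
    also have "\<dots> < \<epsilon>" using g(2)[of m] g(2)[of n] mn commute[of "x m"] by auto
    finally show False using mn q(2)[of m n] by linarith
  qed
  have "inj_on g {n. \<epsilon> \<le> q n}"
    using no_pair by (intro inj_onI) (metis linorder_neqE_nat mem_Collect_eq)
  hence "finite {n. \<epsilon> \<le> q n}"
    using g(1) F(1) by (meson finite_imageD finite_subset image_subsetI)
  thus "\<forall>\<^sub>F n in sequentially. q n < \<epsilon>"
    by (simp add: eventually_cofinite not_less flip: cofinite_eq_sequentially)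
qed

lemma beta_greedy_first:
  assumes "beta_greedy K ip \<Gamma> \<beta> f \<Lambda>"
  obtains l where "l \<in> \<Gamma>" "\<Lambda> 1 = {l}"
  using assms unfolding beta_greedy_def by blast

lemma beta_greedy_stop:
  "beta_greedy K ip \<Gamma> \<beta> f \<Lambda> \<Longrightarrow> n \<ge> 1 \<Longrightarrow> \<Gamma> \<subseteq> fun_vs.span (\<Lambda> n) \<Longrightarrow> \<Lambda> (Suc n) = \<Lambda> n"
  unfolding beta_greedy_def by (elim conjE allE[of _ n]) simp

lemma beta_greedy_select:
  assumes "beta_greedy K ip \<Gamma> \<beta> f \<Lambda>" "n \<ge> 1" "\<not> \<Gamma> \<subseteq> fun_vs.span (\<Lambda> n)"
  obtains l where "l \<in> \<Gamma>" "\<Lambda> (Suc n) = insert l (\<Lambda> n)"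
    "\<And>m. m \<in> \<Gamma> \<Longrightarrow> m \<notin> fun_vs.span (\<Lambda> n)
      \<Longrightarrow> greedy_eta K ip \<beta> f (\<Lambda> n) m \<le> greedy_eta K ip \<beta> f (\<Lambda> n) l"
proof -
  have "\<exists>l \<in> \<Gamma> - fun_vs.span (\<Lambda> n). (\<forall>m \<in> \<Gamma> - fun_vs.span (\<Lambda> n).
      greedy_eta K ip \<beta> f (\<Lambda> n) m \<le> greedy_eta K ip \<beta> f (\<Lambda> n) l) \<and> \<Lambda> (Suc n) = \<Lambda> n \<union> {l}"
    using assms unfolding beta_greedy_def by (elim conjE allE[of _ n]) simp
  thus ?thesis using that by auto
qed

lemma beta_greedy_mono:
  assumes "beta_greedy K ip \<Gamma> \<beta> f \<Lambda>" "n \<ge> 1"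
  shows "\<Lambda> n \<subseteq> \<Lambda> (Suc n)"
proof (cases "\<Gamma> \<subseteq> fun_vs.span (\<Lambda> n)")
  case True
  thus ?thesis using beta_greedy_stop[OF assms] by simp
next
  case False
  obtain l where "\<Lambda> (Suc n) = insert l (\<Lambda> n)" using beta_greedy_select[OF assms False] .
  thus ?thesis by blast
qed

lemma beta_greedy_finite_subset:
  assumes "beta_greedy K ip \<Gamma> \<beta> f \<Lambda>"
  shows "finite (\<Lambda> (Suc n)) \<and> \<Lambda> (Suc n) \<subseteq> \<Gamma>"
proof (induction n)
  case 0
  obtain l where "l \<in> \<Gamma>" "\<Lambda> 1 = {l}" using beta_greedy_first[OF assms] .
  thus ?case by simp
next
  case (Suc n)
  show ?case
  proof (cases "\<Gamma> \<subseteq> fun_vs.span (\<Lambda> (Suc n))")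
    case True
    thus ?thesis using Suc beta_greedy_stop[OF assms, of "Suc n"] by simp
  next
    case False
    have "Suc n \<ge> 1" by simp
    from beta_greedy_select[OF assms this False]
    obtain l where "l \<in> \<Gamma>" "\<Lambda> (Suc (Suc n)) = insert l (\<Lambda> (Suc n))" .
    thus ?thesis using Suc by simp
  qed
qed

locale greedy_run = reproducing_kernel_space K H ip
  for K :: "'x \<Rightarrow> 'x \<Rightarrow> real" and H ip +
  fixes \<Gamma> and \<beta> :: ennreal and f and \<Lambda>
  assumes dual: "\<Gamma> \<subseteq> dual_space H ip"
    and bounded: "totally_bounded_in_dual H ip \<Gamma>"
    and f_mem: "f \<in> H"
    and greedy: "beta_greedy K ip \<Gamma> \<beta> f \<Lambda>"
begin

text \<open>The shift by one makes the index start at \<open>0\<close>: the algorithm counts its sets from \<open>1\<close>.\<close>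

definition selected :: "nat \<Rightarrow> ('x \<Rightarrow> real) set" where
  "selected n = kernel_rep K ` \<Lambda> (Suc n)"

lemma finite_\<Lambda>: "finite (\<Lambda> (Suc n))" and \<Lambda>_subset: "\<Lambda> (Suc n) \<subseteq> \<Gamma>"
  using beta_greedy_finite_subset[OF greedy] by auto

lemma \<Lambda>_dual: "\<Lambda> (Suc n) \<subseteq> dual_space H ip"
  using \<Lambda>_subset dual by blast

lemma finite_selected: "finite (selected n)" and selected_subset: "selected n \<subseteq> H"
  using finite_reps[OF finite_\<Lambda> \<Lambda>_dual] by (auto simp: selected_def)

lemma \<Lambda>_mono: "m \<le> n \<Longrightarrow> \<Lambda> (Suc m) \<subseteq> \<Lambda> (Suc n)"
  using lift_Suc_mono_le[of "\<lambda>n. \<Lambda> (Suc n)"] beta_greedy_mono[OF greedy] by simp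

lemma selected_mono: "m \<le> n \<Longrightarrow> selected m \<subseteq> selected n"
  unfolding selected_def by (intro image_mono \<Lambda>_mono)

lemma greedy_eta_eq:
  assumes "l \<in> \<Gamma>"
  shows "greedy_eta K ip \<beta> f (\<Lambda> (Suc n)) l
    = selection_score \<beta> \<bar>ip (residual (selected n) f) (kernel_rep K l)\<bar>
        (hnorm ip (residual (selected n) (kernel_rep K l)))"
proof -
  have l: "l \<in> dual_space H ip" using assms dual by blast
  show ?thesis
    unfolding greedy_eta_def selection_score_def selected_def
    by (simp only: functional_error[OF finite_\<Lambda> \<Lambda>_dual f_mem l]
        power_function_eq[OF finite_\<Lambda> \<Lambda>_dual l])
qed

text \<open>
  The power function at a newly selected functional is at most its distance to every earlier one.
  Total boundedness does not allow infinitely many functionals with distances bounded below.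
\<close>

lemma selected_power_tendsto_0:
  assumes "\<And>n. s n \<in> \<Gamma>" "\<And>n. s n \<in> \<Lambda> (Suc (Suc n))"
  shows "(\<lambda>n. hnorm ip (residual (selected n) (kernel_rep K (s n)))) \<longlonglongrightarrow> 0"
proof -
  let ?D = "dual_space H ip"
  interpret D: Metric_space ?D "norm_dist ?D (dual_norm H ip)"
    by (rule Metric_space_dual_norm[OF inner])
  have s: "s n \<in> ?D" for n using assms(1) dual by blast
  note rep = kernel_rep_mem[OF s]
  show ?thesis
  proof (rule D.mtotally_bounded_escape[OF _ assms(1)])
    show "D.mtotally_bounded \<Gamma>" using bounded by (simp add: totally_bounded_in_dual_def)
    show "0 \<le> hnorm ip (residual (selected n) (kernel_rep K (s n)))" for n
      using residual_mem[OF finite_selected selected_subset rep] by simp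
    fix m n :: nat assume "m < n"
    hence "s m \<in> \<Lambda> (Suc n)" using assms(2)[of m] \<Lambda>_mono[of "Suc m" n] by auto
    hence "kernel_rep K (s m) \<in> fun_vs.span (selected n)"
      by (auto simp: selected_def intro: fun_vs.span_base)
    hence "hnorm ip (residual (selected n) (kernel_rep K (s n)))
        \<le> hnorm ip (kernel_rep K (s n) - kernel_rep K (s m))"
      by (rule residual_le_distance[OF finite_selected selected_subset rep])
    also have "kernel_rep K (s n) - kernel_rep K (s m) = kernel_rep K (s n - s m)"
      by (simp add: kernel_rep_def fun_eq_iff)
    also have "hnorm ip \<dots> \<le> dual_norm H ip (s n - s m)"
    proof (rule hnorm_kernel_rep_le)
      obtain C where C: "\<forall>g\<in>H. \<bar>s n g\<bar> \<le> C * hnorm ip g"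
        using s[of n] unfolding dual_space_def by blast
      obtain D where D: "\<forall>g\<in>H. \<bar>s m g\<bar> \<le> D * hnorm ip g"
        using s[of m] unfolding dual_space_def by blast
      have "\<forall>g\<in>H. \<bar>s n g - s m g\<bar> \<le> (C + D) * hnorm ip g"
        using C D by (auto simp: distrib_right intro: order_trans[OF abs_triangle_ineq4] add_mono)
      hence "\<exists>C. \<forall>g\<in>H. \<bar>s n g - s m g\<bar> \<le> C * hnorm ip g" by blast
      thus "s n - s m \<in> ?D"
        using s[of n] s[of m] unfolding dual_space_def by (simp add: right_diff_distrib)
    qed
    also have "\<dots> = norm_dist ?D (dual_norm H ip) (s m) (s n)"
      using s D.commute[of "s m" "s n"] by (simp add: norm_dist_def)
    finally show "hnorm ip (residual (selected n) (kernel_rep K (s n)))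
        \<le> norm_dist ?D (dual_norm H ip) (s m) (s n)" .
  qed
qed

text \<open>
  The score of \<open>l\<close> never exceeds that of the selected functional, which tends to \<open>0\<close>, whereas errors of
  at least \<open>c\<close> would keep it above a positive constant. Functionals in the current span compete no
  longer, but their error is already \<open>0\<close>; this also covers an algorithm that stops.
\<close>

lemma functional_error_tendsto_0:
  assumes l: "l \<in> \<Gamma>"
  shows "(\<lambda>n. ip (residual (selected n) f) (kernel_rep K l)) \<longlonglongrightarrow> 0"
proof -
  define v where "v = kernel_rep K l"
  have v: "v \<in> H" unfolding v_def using l dual kernel_rep_mem by blast
  note r = residual_mem[OF finite_selected selected_subset f_mem]
  have in_span: "ip (residual (selected n) f) v = 0" if "l \<in> fun_vs.span (\<Lambda> (Suc n))" for n
    using residual_orthogonal[OF finite_selected selected_subset f_mem] kernel_rep_span[OF that]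
    by (simp add: v_def selected_def)
  show ?thesis
    unfolding v_def[symmetric]
  proof (cases "\<exists>n. \<Gamma> \<subseteq> fun_vs.span (\<Lambda> (Suc n))")
    case True
    then obtain N where N: "\<Gamma> \<subseteq> fun_vs.span (\<Lambda> (Suc N))" by blast
    have "ip (residual (selected n) f) v = 0" if "n \<ge> N" for n
      using in_span[of n] fun_vs.span_mono[OF \<Lambda>_mono[OF that]] N l by blast
    hence "\<forall>\<^sub>F n in sequentially. ip (residual (selected n) f) v = 0"
      by (auto simp: eventually_sequentially)
    thus "(\<lambda>n. ip (residual (selected n) f) v) \<longlonglongrightarrow> 0" by (rule tendsto_eventually)
  next
    case False
    have "\<exists>s. s \<in> \<Gamma> \<and> \<Lambda> (Suc (Suc n)) = insert s (\<Lambda> (Suc n)) \<and>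
        (\<forall>m\<in>\<Gamma>. m \<notin> fun_vs.span (\<Lambda> (Suc n)) \<longrightarrow>
          greedy_eta K ip \<beta> f (\<Lambda> (Suc n)) m \<le> greedy_eta K ip \<beta> f (\<Lambda> (Suc n)) s)" for n
    proof -
      have "Suc n \<ge> 1" "\<not> \<Gamma> \<subseteq> fun_vs.span (\<Lambda> (Suc n))" using False by auto
      from beta_greedy_select[OF greedy this] show ?thesis by metis
    qed
    then obtain s where s: "\<And>n. s n \<in> \<Gamma>" "\<And>n. \<Lambda> (Suc (Suc n)) = insert (s n) (\<Lambda> (Suc n))"
      and max: "\<And>n m. m \<in> \<Gamma> \<Longrightarrow> m \<notin> fun_vs.span (\<Lambda> (Suc n)) \<Longrightarrow>
        greedy_eta K ip \<beta> f (\<Lambda> (Suc n)) m \<le> greedy_eta K ip \<beta> f (\<Lambda> (Suc n)) (s n)"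
      by metis
    let ?d = "\<lambda>n. hnorm ip (residual (selected n) f - residual (selected (Suc n)) f)"
    let ?p = "\<lambda>n. hnorm ip (residual (selected n) (kernel_rep K (s n)))"
    let ?e = "\<lambda>n. \<bar>ip (residual (selected n) f) (kernel_rep K (s n))\<bar>"
    have "kernel_rep K (s n) \<in> selected (Suc n)" for n by (simp add: selected_def s(2))
    hence e: "?e n \<le> ?d n * ?p n" for n
      by (intro ip_residual_le_increment finite_selected selected_subset selected_mono f_mem) auto
    have d: "?d \<longlonglongrightarrow> 0"
      by (intro increments_tendsto_0 finite_selected selected_subset selected_mono f_mem) auto
    have p: "?p \<longlonglongrightarrow> 0" using s by (intro selected_power_tendsto_0) auto
    have score: "(\<lambda>n. selection_score \<beta> (?e n) (?p n)) \<longlonglongrightarrow> 0"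
      using s(1) dual kernel_rep_mem
      by (intro selection_score_tendsto_0[OF _ _ _ e d p])
        (auto intro!: hnorm_nonneg diff_mem residual_mem[OF finite_selected selected_subset] f_mem)
    show "(\<lambda>n. ip (residual (selected n) f) v) \<longlonglongrightarrow> 0"
    proof (rule tendsto_rabs_zero_cancel, rule nonneg_tendsto_0I[OF abs_ge_zero])
      fix c :: real assume "c > 0"
      \<comment> \<open>the summand 1 keeps both bounds positive if \<open>f\<close> or \<open>v\<close> is \<open>0\<close>\<close>
      moreover have "hnorm ip f + 1 > 0" "hnorm ip v + 1 > 0"
        using hnorm_nonneg[OF f_mem] hnorm_nonneg[OF v] by linarith+
      ultimately obtain \<delta> where "\<delta> > 0" and
        below: "\<And>e p. c \<le> e \<Longrightarrow> e \<le> (hnorm ip f + 1) * p \<Longrightarrow> p \<le> hnorm ip v + 1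
          \<Longrightarrow> \<delta> \<le> selection_score \<beta> e p"
        using selection_score_bounded_below by metis
      have "\<bar>ip (residual (selected n) f) v\<bar> < c" if small: "selection_score \<beta> (?e n) (?p n) < \<delta>" for n
      proof (rule ccontr)
        assume large: "\<not> \<bar>ip (residual (selected n) f) v\<bar> < c"
        let ?q = "hnorm ip (residual (selected n) v)"
        have q: "residual (selected n) v \<in> H"
          by (rule residual_mem[OF finite_selected selected_subset v])
        have "\<bar>ip (residual (selected n) f) v\<bar> \<le> hnorm ip (residual (selected n) f) * ?q"
          using Cauchy_Schwarz[OF r[of n] q]
            ip_residual_residual[OF finite_selected selected_subset f_mem v, of n]
          by simp
        also have "\<dots> \<le> (hnorm ip f + 1) * ?q"
          using residual_le[OF finite_selected selected_subset f_mem, of n] q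
          by (intro mult_right_mono) auto
        finally have "\<delta> \<le> selection_score \<beta> \<bar>ip (residual (selected n) f) v\<bar> ?q"
          using large residual_le[OF finite_selected selected_subset v, of n] by (intro below) auto
        also have "\<dots> \<le> selection_score \<beta> (?e n) (?p n)"
          using max[OF l, of n] in_span[of n] large \<open>c > 0\<close>
          unfolding greedy_eta_eq[OF l] greedy_eta_eq[OF s(1)] v_def by fastforce
        finally show False using small by simp
      qed
      thus "\<forall>\<^sub>F n in sequentially. \<bar>ip (residual (selected n) f) v\<bar> < c"
        using order_tendstoD(2)[OF score \<open>\<delta> > 0\<close>] by (rule eventually_mono[rotated])
    qed
  qed
qed

text \<open>
  The residuals are bounded, so weak convergence to \<open>0\<close> passes from the representers of \<open>\<Gamma>\<close> to the
  closure of their span, which contains \<open>f\<close>; and the squared residual norm is the inner product of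
  the residual with \<open>f\<close>.
\<close>

lemma residual_tendsto_0:
  assumes "f \<in> generated_subspace K H ip \<Gamma>"
  shows "(\<lambda>n. hnorm ip (residual (selected n) f)) \<longlonglongrightarrow> 0"
proof -
  interpret M: Metric_space H "norm_dist H (hnorm ip)" by (rule Metric_space_hnorm[OF inner])
  let ?V = "{kernel_rep K l | l. l \<in> \<Gamma>}"
  let ?W = "{g \<in> H. (\<lambda>n. ip (residual (selected n) f) g) \<longlonglongrightarrow> 0}"
  note r = residual_mem[OF finite_selected selected_subset f_mem]
  have "fun_vs.subspace ?W"
  proof (rule fun_vs.subspaceI)
    show "0 \<in> ?W" using r by simp
    show "g + h \<in> ?W" if "g \<in> ?W" "h \<in> ?W" for g h
      using that r by (auto simp: ip_linear intro: tendsto_add_zero)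
    show "fun_scale c g \<in> ?W" if "g \<in> ?W" for c g
      using that r by (auto simp: ip_linear intro: tendsto_mult_right_zero)
  qed
  moreover have "?V \<subseteq> ?W"
    using functional_error_tendsto_0 dual kernel_rep_mem by auto
  ultimately have span: "fun_vs.span ?V \<subseteq> ?W" by (intro fun_vs.span_minimal)
  have "(\<lambda>n. ip (residual (selected n) f) f) \<longlonglongrightarrow> 0"
  proof (rule tendsto_rabs_zero_cancel, rule nonneg_tendsto_0I[OF abs_ge_zero])
    fix \<epsilon> :: real assume \<epsilon>: "\<epsilon> > 0"
    obtain C where C: "C > 0" "hnorm ip f \<le> C"
      using hnorm_nonneg[OF f_mem] by (intro that[of "hnorm ip f + 1"]) linarith+
    \<comment> \<open>so small that the part of the error from replacing \<open>f\<close> by \<open>g\<close> is at most \<open>\<epsilon> / 2\<close>\<close>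
    define \<eta> where "\<eta> = \<epsilon> / 2 / C"
    have \<eta>: "\<eta> > 0" using \<epsilon> C by (simp add: \<eta>_def)
    obtain g where g: "g \<in> fun_vs.span ?V" "g \<in> H" "hnorm ip (f - g) < \<eta>"
      using assms \<eta> unfolding generated_subspace_def M.metric_closure_of
      by (auto simp: norm_dist_def)
    have far: "\<bar>ip (residual (selected n) f) (f - g)\<bar> \<le> \<epsilon> / 2" for n
    proof -
      have "\<bar>ip (residual (selected n) f) (f - g)\<bar> \<le> hnorm ip (residual (selected n) f) * hnorm ip (f - g)"
        using g f_mem r by (intro Cauchy_Schwarz) auto
      also have "\<dots> \<le> C * \<eta>"
        using residual_le[OF finite_selected selected_subset f_mem, of n] g f_mem C
        by (intro mult_mono) auto
      also have "\<dots> = \<epsilon> / 2" using C by (simp add: \<eta>_def)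
      finally show ?thesis .
    qed
    have "(\<lambda>n. \<bar>ip (residual (selected n) f) g\<bar>) \<longlonglongrightarrow> 0"
      using g(1) span by (auto intro: tendsto_rabs_zero)
    hence "\<forall>\<^sub>F n in sequentially. \<bar>ip (residual (selected n) f) g\<bar> < \<epsilon> / 2"
      using \<epsilon> by (intro order_tendstoD(2)) auto
    thus "\<forall>\<^sub>F n in sequentially. \<bar>ip (residual (selected n) f) f\<bar> < \<epsilon>"
    proof (rule eventually_mono)
      fix n assume "\<bar>ip (residual (selected n) f) g\<bar> < \<epsilon> / 2"
      thus "\<bar>ip (residual (selected n) f) f\<bar> < \<epsilon>"
        using far[of n] ip_diff_right[OF r f_mem g(2), of n] by linarith
    qed
  qed
  from tendsto_real_sqrt[OF this]
  have "(\<lambda>n. sqrt (ip (residual (selected n) f) f)) \<longlonglongrightarrow> 0" by simp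
  moreover have "sqrt (ip (residual (selected n) f) f) = hnorm ip (residual (selected n) f)" for n
    using ip_residual_residual[OF finite_selected selected_subset f_mem f_mem, of n] by (simp add: hnorm_def)
  ultimately show ?thesis by simp
qed

end

theorem theorem4p4:
  fixes K :: "real ^ 'd \<Rightarrow> real ^ 'd \<Rightarrow> real"
    and H :: "(real ^ 'd \<Rightarrow> real) set"
    and ip :: "(real ^ 'd \<Rightarrow> real) \<Rightarrow> (real ^ 'd \<Rightarrow> real) \<Rightarrow> real"
    and \<beta> :: ennreal
    and \<Gamma> :: "((real ^ 'd \<Rightarrow> real) \<Rightarrow> real) set"
    and f :: "real ^ 'd \<Rightarrow> real"
    and \<Lambda> :: "nat \<Rightarrow> ((real ^ 'd \<Rightarrow> real) \<Rightarrow> real) set"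
  assumes "positive_definite_kernel K"
    and "is_rkhs K H ip"
    and "\<Gamma> \<subseteq> dual_space H ip"
    and "totally_bounded_in_dual H ip \<Gamma>"
    and "f \<in> generated_subspace K H ip \<Gamma>"
    and "beta_greedy K ip \<Gamma> \<beta> f \<Lambda>"
  shows "(\<lambda>n. hnorm ip (f - interpolant K (\<Lambda> n) f)) \<longlonglongrightarrow> 0"
proof -
  interpret reproducing_kernel_space K H ip by unfold_locales (rule assms(2))
  interpret M: Metric_space H "norm_dist H (hnorm ip)" by (rule Metric_space_hnorm[OF inner])
  have "f \<in> H"
    using assms(5) unfolding generated_subspace_def M.metric_closure_of by simp
  then interpret greedy_run K H ip \<Gamma> \<beta> f \<Lambda> by unfold_locales (use assms in auto)
  have "(\<lambda>n. hnorm ip (f - interpolant K (\<Lambda> (Suc n)) f)) \<longlonglongrightarrow> 0"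
    using residual_tendsto_0[OF assms(5)] interpolation_error[OF finite_\<Lambda> \<Lambda>_dual f_mem]
    by (simp add: selected_def)
  thus ?thesis by (rule LIMSEQ_imp_Suc)
qed

end
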